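(* Let $d\ge1$ be an integer. Every almost injective function $f\colon\mathrm{sk}_d(\Delta_{2d+2})\to\mathbb{R}^{2d}$ (not assumed continuous) satisfies $\alpha^{(2)}(f)\ge r_{2d-1}=\arccos\left(\frac{-1}{2d}\right)$.
   Context: $K=\mathrm{sk}_d(\Delta_{2d+2})$ is the $d$-skeleton of the $(2d+2)$-simplex (geometric realization). A function $f\colon K\to\mathbb{R}^{m}$ is almost injective if $f(\sigma)\cap f(\tau)=\emptyset$ for any two disjoint faces $\sigma,\tau$ of $K$. The 2-fold deleted product is $\mathrm{Conf}_2^{\Delta}(K)=\{(x,y)\in K\times K: x,y \text{ lie in disjoint faces of } K\}$ with the subspace topology. For almost injective $f\colon K\to\mathbb{R}^{2d}$, define $P_f\colon\mathrm{Conf}_2^{\Delta}(K)\to S^{2d-1}$, $P_f(x,y)=\frac{f(x)-f(y)}{\|f(x)-f(y)\|}$, where $S^{2d-1}$ carries the geodesic metric $d(u,v)=\arccos\langle u,v\rangle$, and $\alpha^{(2)}(f)=\delta(P_f)$. Here for a topological space $X$ and a metric space $Y$, $\delta(g)=\inf\{\delta\ge 0 : \text{for every } x\in X \text{ there is an open neighborhood } U_x \text{ of } x \text{ with } \operatorname{diam}(g(U_x))\le\delta\}$. For $n\ge0$, $r_n=\arccos\left(\frac{-1}{n+1}\right)$. *)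

theory Defs
  imports "HOL-Analysis.Analysis"
begin

text \<open>Geometric realization of the simplex with vertex set {0..n}: points are
  barycentric coordinate functions nat => real (product topology on nat => real,
  which on these finitely supported points is the usual Euclidean topology).\<close>

definition supp :: "(nat \<Rightarrow> real) \<Rightarrow> nat set" where
  "supp x = {i. x i \<noteq> 0}"

definition skel_faces :: "nat \<Rightarrow> nat \<Rightarrow> nat set set" where
  "skel_faces n k = {\<sigma>. \<sigma> \<subseteq> {0..n} \<and> \<sigma> \<noteq> {} \<and> card \<sigma> \<le> k + 1}"

definition geom_face :: "nat set \<Rightarrow> (nat \<Rightarrow> real) set" where
  "geom_face \<sigma> = {x. (\<forall>i. 0 \<le> x i) \<and> (\<forall>i. i \<notin> \<sigma> \<longrightarrow> x i = 0) \<and> (\<Sum>i\<in>\<sigma>. x i) = 1}"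

definition skel :: "nat \<Rightarrow> nat \<Rightarrow> (nat \<Rightarrow> real) set" where
  "skel n k = (\<Union>\<sigma>\<in>skel_faces n k. geom_face \<sigma>)"

definition almost_injective :: "nat \<Rightarrow> nat \<Rightarrow> ((nat \<Rightarrow> real) \<Rightarrow> 'a) \<Rightarrow> bool" where
  "almost_injective n k f \<longleftrightarrow>
     (\<forall>\<sigma>\<in>skel_faces n k. \<forall>\<tau>\<in>skel_faces n k. \<sigma> \<inter> \<tau> = {} \<longrightarrow>
        f ` geom_face \<sigma> \<inter> f ` geom_face \<tau> = {})"

definition conf2 :: "nat \<Rightarrow> nat \<Rightarrow> ((nat \<Rightarrow> real) \<times> (nat \<Rightarrow> real)) set" where
  "conf2 n k = {(x, y). x \<in> skel n k \<and> y \<in> skel n k \<and>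
     (\<exists>\<sigma>\<in>skel_faces n k. \<exists>\<tau>\<in>skel_faces n k. \<sigma> \<inter> \<tau> = {} \<and> x \<in> geom_face \<sigma> \<and> y \<in> geom_face \<tau>)}"

definition geod :: "'a::real_inner \<Rightarrow> 'a \<Rightarrow> real" where
  "geod u v = arccos (inner u v)"

definition geod_diam :: "'a::real_inner set \<Rightarrow> real" where
  "geod_diam S = Sup {geod u v | u v. u \<in> S \<and> v \<in> S}"

definition disc_delta :: "'b topology \<Rightarrow> ('b \<Rightarrow> 'a::real_inner) \<Rightarrow> real" where
  "disc_delta X g = Inf {\<delta>. \<delta> \<ge> 0 \<and>
     (\<forall>x\<in>topspace X. \<exists>U. openin X U \<and> x \<in> U \<and> geod_diam (g ` U) \<le> \<delta>)}"

definition P_map :: "((nat \<Rightarrow> real) \<Rightarrow> 'a::real_normed_vector) \<Rightarrow> (nat \<Rightarrow> real) \<times> (nat \<Rightarrow> real) \<Rightarrow> 'a" where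
  "P_map f = (\<lambda>(x, y). (1 / norm (f x - f y)) *\<^sub>R (f x - f y))"

definition alpha2 :: "nat \<Rightarrow> nat \<Rightarrow> ((nat \<Rightarrow> real) \<Rightarrow> 'a::real_inner) \<Rightarrow> real" where
  "alpha2 n k f = disc_delta (top_of_set (conf2 n k)) (P_map f)"

definition r_const :: "nat \<Rightarrow> real" where
  "r_const n = arccos (-1 / (real n + 1))"

end

theory Submission
  imports Defs "HOL-Homology.Homology"
begin

text \<open>
  Suppose \<open>P_f\<close> is locally of diameter less than \<open>arccos (-1/2d)\<close>. Unit vectors of \<open>\<real>\<^sup>2\<^sup>d\<close> that pairwise make
  angles below this bound do not have \<open>0\<close> in their convex hull (by Caratheodory, \<open>2d + 1\<close> of them
  suffice), so averaging the values of \<open>P_f\<close> over a fine symmetric net of the deleted product, with weights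
  depending continuously on the point, gives a continuous odd map to \<open>\<real>\<^sup>2\<^sup>d\<close> without zeros. Together with the
  difference of the two join parameters it extends to an odd map without zeros from the deleted join
  to \<open>\<real>\<^sup>2\<^sup>d\<^sup>+\<^sup>1\<close>. But the deleted join is an antipodal \<open>(2d + 1)\<close>-sphere, which contradicts the Borsuk--Ulam
  theorem.

  Borsuk--Ulam follows from the fact that an odd self-map of \<open>S\<^sup>n\<close> has odd degree. The inductive
  step compares the degrees of an odd map and of its restriction to the equator; for this the map is first
  replaced by an odd polynomial, whose values on the equator miss some line, and then projected along
  this line near the equator.
\<close>

section \<open>Continuous approximation of odd maps into the sphere\<close>

text \<open>Pairing a vanishing convex combination of at most \<open>DIM('a) + 1\<close> vectors
  with itself gives \<open>c + (1 - c) * s \<le> 0\<close> for the sum \<open>s\<close> of the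
  squared weights, while Cauchy-Schwarz gives \<open>s * (DIM('a) + 1) \<ge> 1\<close>. The
  threshold is the inner product of two vertices of a regular simplex inscribed in the unit
  sphere.\<close>

lemma zero_notin_convex_hull_unit_vectors:
  fixes S :: "'a::euclidean_space set"
  assumes unit: "\<And>v. v \<in> S \<Longrightarrow> norm v = 1"
    and inner: "\<And>v w. v \<in> S \<Longrightarrow> w \<in> S \<Longrightarrow> v \<bullet> w \<ge> c"
    and c: "c > - 1 / DIM('a)"
  shows "0 \<notin> convex hull S"
proof
  assume "0 \<in> convex hull S"
  then obtain T where T: "finite T" "T \<subseteq> S" "card T \<le> DIM('a) + 1" "0 \<in> convex hull T"
    unfolding caratheodory[of S] by auto
  then obtain u where u: "\<And>v. v \<in> T \<Longrightarrow> 0 \<le> u v" "sum u T = 1" "(\<Sum>v\<in>T. u v *\<^sub>R v) = 0"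
    unfolding convex_hull_finite[OF T(1)] by auto
  define m where "m = real (DIM('a))"
  have m: "m > 0" by (simp add: m_def)
  obtain v0 where "v0 \<in> T" using u(2) by fastforce
  then have c1: "c \<le> 1"
    using inner[of v0 v0] unit[of v0] T(2) by (auto simp: norm_eq_1)
  have "0 = (\<Sum>v\<in>T. u v *\<^sub>R v) \<bullet> (\<Sum>w\<in>T. u w *\<^sub>R w)" by (simp add: u(3))
  also have "\<dots> = (\<Sum>v\<in>T. \<Sum>w\<in>T. u v * u w * (v \<bullet> w))"
    unfolding inner_sum_left by (simp add: inner_sum_right sum_distrib_left mult_ac)
  \<comment> \<open>The bound \<open>c\<close> holds off the diagonal; the diagonal term is exactly
    \<open>1 = c + (1 - c)\<close>.\<close>
  also have "\<dots> \<ge> (\<Sum>v\<in>T. \<Sum>w\<in>T. u v * u w * (c + (if v = w then 1 - c else 0)))"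
  proof (intro sum_mono mult_left_mono)
    fix v w assume "v \<in> T" "w \<in> T"
    then show "c + (if v = w then 1 - c else 0) \<le> v \<bullet> w"
      using inner[of v w] unit[of v] T(2) by (auto simp: norm_eq_1)
  qed (use u in auto)
  also have "(\<Sum>v\<in>T. \<Sum>w\<in>T. u v * u w * (c + (if v = w then 1 - c else 0)))
      = (\<Sum>v\<in>T. \<Sum>w\<in>T. c * (u v * u w)) + (\<Sum>v\<in>T. \<Sum>w\<in>T. if v = w then (1 - c) * (u v)\<^sup>2 else 0)"
    unfolding sum.distrib[symmetric]
    by (intro sum.cong refl) (auto simp: algebra_simps power2_eq_square)
  also have "(\<Sum>v\<in>T. \<Sum>w\<in>T. c * (u v * u w)) = c"
    using u(2) by (simp flip: sum_distrib_left sum_distrib_right)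
  also have "(\<Sum>v\<in>T. \<Sum>w\<in>T. if v = w then (1 - c) * (u v)\<^sup>2 else 0) = (1 - c) * (\<Sum>v\<in>T. (u v)\<^sup>2)"
    using T(1) by (simp add: sum_distrib_left)
  finally have le: "c + (1 - c) * (\<Sum>v\<in>T. (u v)\<^sup>2) \<le> 0" .
  have "1 \<le> (\<Sum>v\<in>T. (u v)\<^sup>2) * card T"
    using sum_squared_le_sum_of_squares[of u T] u(2) by simp
  also have "\<dots> \<le> (\<Sum>v\<in>T. (u v)\<^sup>2) * (m + 1)"
    using T(3) by (intro mult_left_mono) (auto simp: m_def sum_nonneg)
  finally have "(1 - c) * 1 \<le> (1 - c) * ((\<Sum>v\<in>T. (u v)\<^sup>2) * (m + 1))"
    using c1 by (intro mult_left_mono) auto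
  then have "(1 - c) + c * (m + 1) \<le> (c + (1 - c) * (\<Sum>v\<in>T. (u v)\<^sup>2)) * (m + 1)"
    by (simp add: algebra_simps)
  also have "\<dots> \<le> 0" using le m by (simp add: mult_nonpos_nonneg)
  finally have "1 + c * m \<le> 0" by (simp add: algebra_simps)
  moreover have "1 + c * m > 0" using c m by (simp add: m_def field_simps)
  ultimately show False by simp
qed

lemma dist_swap: "dist (prod.swap p) q = dist p (prod.swap q)"
  by (cases p; cases q) (simp add: dist_Pair_Pair add.commute)

text \<open>\<open>F\<close> averages \<open>g\<close> over a finite net with hat functions of
  radius \<open>e\<close> as weights. Since \<open>e\<close> is a Lebesgue number of a cover by sets
  of small variation, the net points with nonzero weight at \<open>p\<close> have values satisfying
  the previous lemma, and \<open>F p\<close> is a positive multiple of a point of their convex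
  hull.\<close>

lemma odd_map_continuous_approximation:
  fixes C :: "('m::metric_space \<times> 'm) set" and g :: "'m \<times> 'm \<Rightarrow> 'a::euclidean_space"
  assumes C: "compact C" and swap: "\<And>p. p \<in> C \<Longrightarrow> prod.swap p \<in> C"
    and godd: "\<And>p. p \<in> C \<Longrightarrow> g (prod.swap p) = - g p"
    and unit: "\<And>p. p \<in> C \<Longrightarrow> norm (g p) = 1"
    and loc: "\<And>p. p \<in> C \<Longrightarrow> \<exists>U. openin (top_of_set C) U \<and> p \<in> U \<and> (\<forall>x\<in>U. \<forall>y\<in>U. g x \<bullet> g y \<ge> c)"
    and c: "c > - 1 / DIM('a)"
  obtains F :: "'m \<times> 'm \<Rightarrow> 'a" where "continuous_on UNIV F" "\<And>p. F (prod.swap p) = - F p" "\<And>p. p \<in> C \<Longrightarrow> F p \<noteq> 0"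
proof -
  define \<G> where "\<G> = {V. open V \<and> (\<forall>x\<in>C \<inter> V. \<forall>y\<in>C \<inter> V. g x \<bullet> g y \<ge> c)}"
  have cov: "C \<subseteq> \<Union>\<G>"
  proof
    fix p assume "p \<in> C"
    then obtain U where "openin (top_of_set C) U" "p \<in> U" "\<forall>x\<in>U. \<forall>y\<in>U. g x \<bullet> g y \<ge> c"
      using loc by blast
    then show "p \<in> \<Union>\<G>" unfolding \<G>_def openin_open by blast
  qed
  obtain e where e: "e > 0" "\<And>x. x \<in> C \<Longrightarrow> \<exists>V\<in>\<G>. ball x e \<subseteq> V"
    using Heine_Borel_lemma[OF C cov] by (auto simp: \<G>_def)
  obtain k0 where k0: "finite k0" "k0 \<subseteq> C" "C \<subseteq> (\<Union>x\<in>k0. ball x e)"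
    using seq_compact_imp_totally_bounded[of C] C e(1) by (auto simp: compact_eq_seq_compact_metric)
  \<comment> \<open>Closing the net under the swap makes \<open>F\<close> exactly odd, by reindexing
    the sum.\<close>
  define k where "k = k0 \<union> prod.swap ` k0"
  have k: "finite k" "k \<subseteq> C" "C \<subseteq> (\<Union>x\<in>k. ball x e)"
    using k0 swap by (auto simp: k_def)
  have bij: "bij_betw prod.swap k k"
    by (rule bij_betwI[of _ _ _ prod.swap]) (auto simp: k_def)
  define w where "w p q = max 0 (e - dist p q)" for p q :: "'m \<times> 'm"
  define F where "F p = (\<Sum>q\<in>k. w p q *\<^sub>R g q)" for p
  show thesis
  proof (rule that[of F])
    show "continuous_on UNIV F" unfolding F_def w_def by (intro continuous_intros)
    show "F (prod.swap p) = - F p" for p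
    proof -
      have "F (prod.swap p) = (\<Sum>q\<in>k. w (prod.swap p) (prod.swap q) *\<^sub>R g (prod.swap q))"
        unfolding F_def by (rule sum.reindex_bij_betw[OF bij, symmetric])
      also have "\<dots> = (\<Sum>q\<in>k. - (w p q *\<^sub>R g q))"
      proof (rule sum.cong)
        fix q assume "q \<in> k"
        then have "g (prod.swap q) = - g q" using k(2) godd by blast
        then show "w (prod.swap p) (prod.swap q) *\<^sub>R g (prod.swap q) = - (w p q *\<^sub>R g q)"
          by (simp add: w_def dist_swap)
      qed simp
      finally show ?thesis by (simp add: F_def sum_negf)
    qed
    show "F p \<noteq> 0" if p: "p \<in> C" for p
    proof
      assume F0: "F p = 0"
      define s where "s = (\<Sum>q\<in>k. w p q)"
      obtain q0 where "q0 \<in> k" "p \<in> ball q0 e" using k(3) p by blast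
      then have s: "s > 0" unfolding s_def
        using k(1) by (intro sum_pos2[of k q0]) (auto simp: w_def dist_commute)
      define k' where "k' = k \<inter> ball p e"
      have w0: "w p q = 0" if "q \<notin> ball p e" for q using that by (auto simp: w_def)
      have s': "s = (\<Sum>q\<in>k'. w p q)" unfolding s_def k'_def
        using k(1) w0 by (intro sum.mono_neutral_right) auto
      have F': "F p = (\<Sum>q\<in>k'. w p q *\<^sub>R g q)" unfolding F_def k'_def
        using k(1) w0 by (intro sum.mono_neutral_right) auto
      have "(\<Sum>q\<in>k'. (w p q / s) *\<^sub>R g q) \<in> convex hull (g ` k')"
        using k(1) s by (intro convex_sum convex_convex_hull)
          (auto simp: k'_def w_def s' hull_inc simp flip: sum_divide_distrib)
      moreover have "(\<Sum>q\<in>k'. (w p q / s) *\<^sub>R g q) = (1 / s) *\<^sub>R F p"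
        unfolding F' by (simp add: scaleR_sum_right)
      ultimately have "0 \<in> convex hull (g ` k')" using F0 by simp
      moreover have "0 \<notin> convex hull (g ` k')"
      proof (rule zero_notin_convex_hull_unit_vectors[OF _ _ c])
        show "norm v = 1" if "v \<in> g ` k'" for v
          using that k(2) unit by (auto simp: k'_def)
        obtain V where "V \<in> \<G>" "ball p e \<subseteq> V" using e(2)[OF p] by blast
        then show "v \<bullet> u \<ge> c" if "v \<in> g ` k'" "u \<in> g ` k'" for v u
          using that k(2) unfolding \<G>_def k'_def by blast
      qed
      ultimately show False by simp
    qed
  qed
qed

section \<open>The Borsuk--Ulam theorem\<close>

text \<open>The underlying set of \<open>nsphere n\<close>. All spheres lie in one function space,
  so \<open>sph n\<close> itself is the equator of \<open>sph (Suc n)\<close>.\<close>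

definition sph :: "nat \<Rightarrow> (nat \<Rightarrow> real) set" where
  "sph n = {x. (\<Sum>i\<le>n. (x i)\<^sup>2) = 1 \<and> (\<forall>i>n. x i = 0)}"

definition normalize_sph :: "nat \<Rightarrow> (nat \<Rightarrow> real) \<Rightarrow> nat \<Rightarrow> real" where
  "normalize_sph n x = (\<lambda>i. x i / sqrt (\<Sum>j\<le>n. (x j)\<^sup>2))"

lemma nsphere_eq_top_of_sph: "nsphere n = top_of_set (sph n)"
  by (simp add: nsphere sph_def euclidean_product_topology)

lemma topspace_nsphere_eq_sph: "topspace (nsphere n) = sph n"
  by (simp add: nsphere_eq_top_of_sph)

lemma minus_in_sph: "x \<in> sph n \<Longrightarrow> - x \<in> sph n"
  by (simp add: sph_def)

lemma sph_imp_nonzero: "x \<in> sph n \<Longrightarrow> \<exists>i\<le>n. x i \<noteq> 0"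
  by (rule ccontr) (auto simp: sph_def)

lemma equator_in_sph: "x \<in> sph n \<Longrightarrow> x \<in> sph (Suc n) \<and> x (Suc n) = 0"
  by (auto simp: sph_def)

lemma sph_equator: "x \<in> sph (Suc n) \<Longrightarrow> x (Suc n) = 0 \<Longrightarrow> x \<in> sph n"
  using topspace_nsphere_minus1[of x "Suc n"] by (simp add: topspace_nsphere_eq_sph)

lemma sum_squares_pos:
  fixes x :: "nat \<Rightarrow> real"
  assumes "\<exists>i\<le>n. x i \<noteq> 0"
  shows "(\<Sum>i\<le>n. (x i)\<^sup>2) > 0"
  using assms by (auto intro: sum_pos2)

lemma normalize_sph_in_sph:
  assumes "\<exists>i\<le>n. x i \<noteq> 0" "\<And>i. i > n \<Longrightarrow> x i = 0"
  shows "normalize_sph n x \<in> sph n"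
  using sum_squares_pos[OF assms(1)] assms(2)
  by (simp add: sph_def normalize_sph_def power_divide flip: sum_divide_distrib)

lemma normalize_sph_id: "x \<in> sph n \<Longrightarrow> normalize_sph n x = x"
  by (simp add: sph_def normalize_sph_def)

lemma normalize_sph_minus: "normalize_sph n (- x) = - normalize_sph n x"
  by (simp add: normalize_sph_def fun_eq_iff)

lemma continuous_on_normalize_sph:
  assumes "continuous_on S f" "\<And>x. x \<in> S \<Longrightarrow> \<exists>i\<le>n. f x i \<noteq> 0"
  shows "continuous_on S (\<lambda>x. normalize_sph n (f x))"
proof -
  have "(\<Sum>j\<le>n. (f x j)\<^sup>2) \<noteq> 0" if "x \<in> S" for x
    using sum_squares_pos[OF assms(2)[OF that]] by simp
  then show ?thesis
    unfolding normalize_sph_def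
    by (intro continuous_on_coordinatewise_then_product continuous_intros
        continuous_on_product_then_coordinatewise[OF assms(1)]) auto
qed

text \<open>Lets homotopies be written by linear formulas: they only have to avoid the origin, and
  normalizing brings them back to the sphere.\<close>

lemma Brouwer_degree2_normalize_homotopy:
  fixes H :: "real \<times> (nat \<Rightarrow> real) \<Rightarrow> nat \<Rightarrow> real"
  assumes H: "continuous_on ({0..1} \<times> sph n) H"
    and nz: "\<And>t x. t \<in> {0..1} \<Longrightarrow> x \<in> sph n \<Longrightarrow> \<exists>i\<le>n. H (t, x) i \<noteq> 0"
    and z: "\<And>t x i. t \<in> {0..1} \<Longrightarrow> x \<in> sph n \<Longrightarrow> i > n \<Longrightarrow> H (t, x) i = 0"
  shows "Brouwer_degree2 n (\<lambda>x. normalize_sph n (H (0, x)))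
       = Brouwer_degree2 n (\<lambda>x. normalize_sph n (H (1, x)))"
proof (rule Brouwer_degree2_homotopic)
  have "continuous_on ({0..1} \<times> sph n) (\<lambda>p. normalize_sph n (H p))"
    using nz by (intro continuous_on_normalize_sph H) auto
  moreover have "(\<lambda>p. normalize_sph n (H p)) ` ({0..1} \<times> sph n) \<subseteq> sph n"
    using nz z by (auto intro!: normalize_sph_in_sph)
  ultimately show "homotopic_with (\<lambda>x. True) (nsphere n) (nsphere n)
      (\<lambda>x. normalize_sph n (H (0, x))) (\<lambda>x. normalize_sph n (H (1, x)))"
    unfolding nsphere_eq_top_of_sph homotopic_with_def
    by (simp add: image_subset_iff_funcset) (intro exI[of _ "\<lambda>p. normalize_sph n (H p)"] conjI allI refl)
qed

text \<open>The odd part of a polynomial approximation of \<open>f\<close> is differentiable, so the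
  cone over its image of the equator is negligible and some direction \<open>v\<close> avoids it.
  The type \<open>'e\<close> supplies a Euclidean space large enough to contain the sphere, where
  polynomial approximation and negligible sets are available.\<close>

lemma odd_polynomial_general_position:
  fixes f :: "(nat \<Rightarrow> real) \<Rightarrow> nat \<Rightarrow> real"
  assumes dim: "n < DIM('e::euclidean_space)"
    and contf: "continuous_on (sph n) f"
    and fim: "\<And>x. x \<in> sph n \<Longrightarrow> f x \<in> sph n"
    and oddf: "\<And>x. x \<in> sph n \<Longrightarrow> f (- x) = - f x"
  obtains q v where "continuous_on (sph n) q"
    and "\<And>x i. x \<in> sph n \<Longrightarrow> i > n \<Longrightarrow> q x i = 0"
    and "\<And>x. q (- x) = - q x"
    and "\<And>x. x \<in> sph n \<Longrightarrow> (\<Sum>i\<le>n. (f x i - q x i)\<^sup>2) < 1"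
    and "v n \<noteq> 0" and "\<And>i. i > n \<Longrightarrow> v i = 0"
    and "\<And>x c. x \<in> sph n \<Longrightarrow> x n = 0 \<Longrightarrow> q x \<noteq> (\<lambda>i. c * v i)"
proof -
  let ?D = "DIM('e)"
  obtain b :: "nat \<Rightarrow> 'e" where b: "bij_betw b {..<?D} Basis"
    using ex_bij_betw_nat_finite[OF finite_Basis] by (metis atLeast0LessThan)
  have bB: "b i \<in> Basis" if "i < ?D" for i
    using b that by (auto simp: bij_betw_def)
  have bb: "b i \<bullet> b j = (if i = j then 1 else 0)" if "i < ?D" "j < ?D" for i j
    using b bB that by (auto simp: inner_Basis bij_betw_def inj_on_def)
  have rep: "(\<Sum>i<?D. (e \<bullet> b i) *\<^sub>R b i) = e" for e
    using sum.reindex_bij_betw[OF b, of "\<lambda>k. (e \<bullet> k) *\<^sub>R k"] by (simp add: euclidean_representation)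
  have ext: "e = e'" if "\<And>i. i < ?D \<Longrightarrow> e \<bullet> b i = e' \<bullet> b i" for e e' :: 'e
    using that rep[of e] rep[of e'] by (metis (no_types, lifting) lessThan_iff sum.cong)
  have nrm: "(norm e)\<^sup>2 = (\<Sum>i<?D. (e \<bullet> b i)\<^sup>2)" for e
    using sum.reindex_bij_betw[OF b, of "\<lambda>k. (e \<bullet> k)\<^sup>2"]
    unfolding power2_norm_eq_inner by (subst euclidean_inner) (simp add: power2_eq_square)
  \<comment> \<open>\<open>toE\<close> and \<open>fr\<close> translate between coordinate functions
    and \<open>'e\<close>; the set \<open>K\<close> below is the copy of \<open>sph n\<close> in
    \<open>'e\<close>.\<close>
  define toE :: "(nat \<Rightarrow> real) \<Rightarrow> 'e" where "toE x = (\<Sum>i\<le>n. x i *\<^sub>R b i)" for x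
  define fr :: "'e \<Rightarrow> nat \<Rightarrow> real" where "fr e i = (if i \<le> n then e \<bullet> b i else 0)" for e i
  have toE_b: "toE x \<bullet> b j = (if j \<le> n then x j else 0)" if "j < ?D" for x j
  proof -
    have "toE x \<bullet> b j = (\<Sum>i\<le>n. if i = j then x i else 0)"
      unfolding toE_def inner_sum_left using dim that by (intro sum.cong) (auto simp: bb)
    then show ?thesis by simp
  qed
  have fr_toE: "fr (toE x) = x" if "x \<in> sph n" for x
    using that dim by (auto simp: fr_def toE_b sph_def fun_eq_iff)
  have toE_minus: "toE (- x) = - toE x" for x
    by (simp add: toE_def sum_negf)
  have fr_minus: "fr (- e) = - fr e" for e
    by (simp add: fr_def fun_eq_iff)
  have split: "{..<?D} = {..n} \<union> {n<..<?D}" using dim by auto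
  have sumsplit: "(\<Sum>i<?D. g i) = (\<Sum>i\<le>n. g i) + (\<Sum>i\<in>{n<..<?D}. g i)" for g :: "nat \<Rightarrow> real"
    unfolding split by (rule sum.union_disjoint) auto
  define K where "K = sphere 0 1 \<inter> (\<Inter>i\<in>{n<..<?D}. {e::'e. e \<bullet> b i = 0})"
  have K: "compact K"
    unfolding K_def
    by (intro compact_Int_closed compact_sphere closed_INT ballI closed_Collect_eq continuous_intros)
  have toE_K: "toE x \<in> K" if "x \<in> sph n" for x
  proof -
    have "(norm (toE x))\<^sup>2 = 1"
      using that dim by (simp add: nrm sumsplit toE_b sph_def)
    then have "norm (toE x) = 1" by (simp add: power2_eq_1_iff) (smt (verit) norm_ge_zero)
    then show ?thesis by (auto simp: K_def toE_b)
  qed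
  have fr_K: "fr e \<in> sph n" if "e \<in> K" for e
  proof -
    have "(\<Sum>i<?D. (e \<bullet> b i)\<^sup>2) = 1" using that nrm[of e] by (simp add: K_def)
    then show ?thesis using that by (simp add: sumsplit K_def sph_def fr_def)
  qed
  have cont_fr: "continuous_on S fr" for S
    unfolding fr_def
  proof (rule continuous_on_coordinatewise_then_product)
    show "continuous_on S (\<lambda>e. if i \<le> n then e \<bullet> b i else 0)" for i
      by (cases "i \<le> n") (auto intro!: continuous_intros)
  qed
  have cont_toE: "continuous_on S (\<lambda>x. toE (g x))" if "continuous_on S g" for S and g :: "'z::topological_space \<Rightarrow> nat \<Rightarrow> real"
    unfolding toE_def by (intro continuous_intros continuous_on_product_then_coordinatewise[OF that])
  have "continuous_on K (\<lambda>e. toE (f (fr e)))"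
    using fr_K by (intro cont_toE continuous_on_compose2[OF contf cont_fr]) auto
  then obtain p where p: "polynomial_function p" "\<And>e. e \<in> K \<Longrightarrow> norm (toE (f (fr e)) - p e) < 1"
    using Stone_Weierstrass_polynomial_function[OF K _ zero_less_one, of "\<lambda>e. toE (f (fr e))"] by auto
  \<comment> \<open>Because \<open>f\<close> is odd, passing to the odd part of \<open>p\<close>
    keeps the error below 1.\<close>
  define Q where "Q e = (1/2) *\<^sub>R (p e - p (- e))" for e
  have Qodd: "Q (- e) = - Q e" for e by (simp add: Q_def algebra_simps)
  have pd: "p differentiable at e" for e
    using p(1) by (rule differentiable_at_polynomial_function)
  have "(\<lambda>e. p (- e)) differentiable at e" for e
    using differentiable_compose[of p uminus e UNIV] pd by (simp add: o_def)
  then have Qd: "Q differentiable at e" for e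
    unfolding Q_def by (intro derivative_intros pd) auto
  define q where "q x = fr (Q (toE x))" for x
  have contq: "continuous_on (sph n) q"
  proof -
    have "continuous_on UNIV Q"
      by (metis Qd differentiable_imp_continuous_within continuous_at_imp_continuous_on)
    then show ?thesis unfolding q_def
      by (intro continuous_on_compose2[OF cont_fr[of UNIV]] continuous_on_compose2[OF _ cont_toE]) auto
  qed
  have qodd: "q (- x) = - q x" for x by (simp add: q_def toE_minus Qodd fr_minus)
  have close: "(\<Sum>i\<le>n. (f x i - q x i)\<^sup>2) < 1" if x: "x \<in> sph n" for x
  proof -
    define e where "e = toE x"
    have e: "e \<in> K" "- e \<in> K" "fr e = x"
      using toE_K[OF x] toE_K[OF minus_in_sph[OF x]] fr_toE[OF x] by (auto simp: e_def toE_minus)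
    have 1: "norm (toE (f x) - p e) < 1" using p(2)[OF e(1)] e(3) by simp
    have 2: "norm (- toE (f x) - p (- e)) < 1"
      using p(2)[OF e(2)] by (simp add: fr_minus e(3) oddf[OF x] toE_minus)
    have "toE (f x) - Q e = (1/2) *\<^sub>R ((toE (f x) - p e) - (- toE (f x) - p (- e)))"
      by (simp add: Q_def algebra_simps flip: scaleR_add_left)
    then have "norm (toE (f x) - Q e) \<le> (1/2) * (norm (toE (f x) - p e) + norm (- toE (f x) - p (- e)))"
      using norm_triangle_ineq4[of "toE (f x) - p e" "- toE (f x) - p (- e)"] by simp
    then have "norm (toE (f x) - Q e) < 1" using 1 2 by simp
    then have "(norm (toE (f x) - Q e))\<^sup>2 < 1"
      by (simp add: power_less_one_iff abs_square_less_1)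
    moreover have "(norm (toE (f x) - Q e))\<^sup>2 \<ge> (\<Sum>i\<le>n. ((toE (f x) - Q e) \<bullet> b i)\<^sup>2)"
      unfolding nrm sumsplit by (simp add: sum_nonneg)
    moreover have "(\<Sum>i\<le>n. ((toE (f x) - Q e) \<bullet> b i)\<^sup>2) = (\<Sum>i\<le>n. (f x i - q x i)\<^sup>2)"
      using dim by (intro sum.cong) (auto simp: inner_diff_left toE_b q_def e_def fr_def)
    ultimately show ?thesis by linarith
  qed
  \<comment> \<open>\<open>\<Psi>\<close> parametrises the cone over \<open>q\<close> of the equator by the hyperplane without coordinate \<open>n\<close>. Carrying
    the coordinates above \<open>n\<close> along unchanged (\<open>W\<close>) makes its image negligible in all of \<open>'e\<close>, so that
    the induction over \<open>n\<close> below can be carried out with one fixed type.\<close>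
  define Y where "Y e = (\<Sum>i<n. (e \<bullet> b i) *\<^sub>R b i)" for e
  define W where "W e = (\<Sum>i\<in>{n<..<?D}. (e \<bullet> b i) *\<^sub>R b i)" for e
  define P where "P e = (\<Sum>i\<le>n. (e \<bullet> b i) *\<^sub>R b i)" for e
  have P_eq: "P e = toE (fr e)" for e by (simp add: P_def toE_def fr_def)
  define \<Psi> where "\<Psi> e = norm (Y e) *\<^sub>R P (Q ((1 / norm (Y e)) *\<^sub>R Y e)) + W e" for e
  define T where "T = {e::'e. e \<bullet> b n = 0 \<and> Y e \<noteq> 0}"
  have blY: "bounded_linear Y" and blW: "bounded_linear W" and blP: "bounded_linear P"
    unfolding Y_def W_def P_def
    by (simp_all add: bounded_linear_sum bounded_linear_scaleR_const bounded_linear_inner_left)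
  have "\<Psi> differentiable at e" if "e \<in> T" for e
  proof -
    have Ye: "Y e \<noteq> 0" using that by (simp add: T_def)
    have Yd: "Y differentiable at e"
      by (rule bounded_linear_imp_differentiable[OF blY])
    have nY: "(\<lambda>e. norm (Y e)) differentiable at e"
      using differentiable_compose[OF differentiable_norm_at[OF Ye] Yd] .
    have "(\<lambda>e. (1 / norm (Y e)) *\<^sub>R Y e) differentiable at e"
      using Ye by (intro derivative_intros differentiable_scaleR differentiable_divide nY Yd) auto
    then have "(\<lambda>e. Q ((1 / norm (Y e)) *\<^sub>R Y e)) differentiable at e"
      by (rule differentiable_compose[OF Qd])
    then have "(\<lambda>e. P (Q ((1 / norm (Y e)) *\<^sub>R Y e))) differentiable at e"
      by (rule differentiable_compose[OF bounded_linear_imp_differentiable[OF blP]])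
    then show ?thesis unfolding \<Psi>_def
      by (intro differentiable_add differentiable_scaleR nY bounded_linear_imp_differentiable[OF blW])
  qed
  then have "\<Psi> differentiable_on T"
    by (simp add: differentiable_at_imp_differentiable_on)
  moreover have hyp: "negligible {e::'e. e \<bullet> b n = 0}"
    by (rule negligible_standard_hyperplane[OF bB[OF dim]])
  then have "negligible T" by (rule negligible_subset) (auto simp: T_def)
  ultimately have "negligible (\<Psi> ` T)"
    by (intro negligible_differentiable_image_negligible) auto
  \<comment> \<open>Removing the hyperplane as well ensures \<open>v n \<noteq> 0\<close>.\<close>
  then have "negligible (\<Psi> ` T \<union> {e. e \<bullet> b n = 0})" using hyp by simp
  then obtain u where u: "u \<notin> \<Psi> ` T" "u \<bullet> b n \<noteq> 0"
    by (metis (mono_tags, lifting) UNIV_eq_I UnCI mem_Collect_eq non_negligible_UNIV)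
  define v where "v = fr u"
  have qne0: "\<exists>i\<le>n. q x i \<noteq> 0" if "x \<in> sph n" for x
    using close[OF that] fim[OF that] by (rule_tac ccontr) (auto simp: sph_def)
  \<comment> \<open>The point \<open>e\<close> is built as a preimage of \<open>u\<close>: its
    \<open>Y\<close>-part has norm \<open>1/c\<close>, which cancels the factor \<open>c\<close>,
    and its \<open>W\<close>-part supplies the remaining coordinates of \<open>u\<close>.\<close>
  have pos: False if x: "x \<in> sph n" "x n = 0" and q: "q x = (\<lambda>i. c * v i)" and c: "c > 0" for x c
  proof -
    define e where "e = (1/c) *\<^sub>R toE x + W u"
    have Wb: "W u \<bullet> b j = (if n < j then u \<bullet> b j else 0)" if "j < ?D" for j
    proof -
      have "W u \<bullet> b j = (\<Sum>i\<in>{n<..<?D}. if i = j then u \<bullet> b i else 0)"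
        unfolding W_def inner_sum_left using that by (intro sum.cong) (auto simp: bb)
      then show ?thesis using that by simp
    qed
    have Yb: "Y e \<bullet> b j = (if j < n then e \<bullet> b j else 0)" if "j < ?D" for j and e
    proof -
      have "Y e \<bullet> b j = (\<Sum>i<n. if i = j then e \<bullet> b i else 0)"
        unfolding Y_def inner_sum_left using that dim by (intro sum.cong) (auto simp: bb)
      then show ?thesis by simp
    qed
    have Ye: "Y e = (1/c) *\<^sub>R toE x"
      by (rule ext) (use x in \<open>auto simp: Yb e_def inner_add_left toE_b Wb\<close>)
    have nt: "norm (toE x) = 1" using toE_K[OF x(1)] by (simp add: K_def)
    have We: "W e = W u"
      unfolding W_def by (intro sum.cong) (auto simp: e_def inner_add_left toE_b Wb)
    have "e \<in> T"
      using c nt x dim Ye by (auto simp: T_def e_def inner_add_left toE_b Wb)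
    moreover have "\<Psi> e = u"
    proof (rule ext)
      fix i assume i: "i < ?D"
      have "P (Q (toE x)) = toE (\<lambda>i. c * v i)"
        by (simp add: P_eq q flip: q_def)
      then have "\<Psi> e = (1/c) *\<^sub>R toE (\<lambda>i. c * v i) + W u"
        using c by (simp add: \<Psi>_def Ye We nt)
      then show "\<Psi> e \<bullet> b i = u \<bullet> b i"
        using c i by (auto simp: inner_add_left toE_b Wb v_def fr_def)
    qed
    ultimately show False using u by blast
  qed
  have "q x \<noteq> (\<lambda>i. c * v i)" if x: "x \<in> sph n" "x n = 0" for x c
  proof
    assume q: "q x = (\<lambda>i. c * v i)"
    consider "c = 0" | "c > 0" | "c < 0" by linarith
    then show False
    proof cases
      case 1 then show ?thesis using qne0[OF x(1)] q by simp
    next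
      case 2 then show ?thesis using pos[OF x q] by simp
    next
      \<comment> \<open>Passing to the antipode changes the sign of \<open>c\<close>.\<close>
      case 3
      have "q (- x) = (\<lambda>i. (- c) * v i)" using q by (simp add: qodd fun_eq_iff)
      then show ?thesis using pos[of "- x" "- c"] x 3 minus_in_sph by auto
    qed
  qed
  moreover have "v n \<noteq> 0" "\<And>i. i > n \<Longrightarrow> v i = 0" using u by (auto simp: v_def fr_def)
  ultimately show thesis
    using that[of q v] contq qodd close by (auto simp: q_def fr_def)
qed

section \<open>Parity of the degree and the antipodal theorem\<close>

lemma sph_0_cases: "x \<in> sph 0 \<Longrightarrow> y \<in> sph 0 \<Longrightarrow> y = x \<or> y = - x"
proof -
  assume x: "x \<in> sph 0" and y: "y \<in> sph 0"
  have 0: "y 0 = x 0 \<or> y 0 = - x 0" and i: "x i = 0 \<and> y i = 0" if "i \<noteq> 0" for i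
    using x y that by (auto simp: sph_def power2_eq_1_iff)
  have "y = x" if "y 0 = x 0"
  proof
    fix i show "y i = x i" using i[of i] that by (cases "i = 0") auto
  qed
  moreover have "y = - x" if "y 0 = - x 0"
  proof
    fix i show "y i = (- x) i" using i[of i] that by (cases "i = 0") auto
  qed
  ultimately show ?thesis using 0[of 1] by blast
qed

text \<open>Induction on \<open>n\<close>. On the two points of \<open>sph 0\<close> the map is the
  identity or the reflection. In the step, \<open>f\<close> is deformed through \<open>q\<close> to
  an odd map \<open>h\<close> preserving the equator; its degree has the same parity as that of its
  restriction there.\<close>

theorem Brouwer_degree2_odd:
  assumes "n < DIM('e::euclidean_space)"
    and "continuous_on (sph n) f"
    and "\<And>x. x \<in> sph n \<Longrightarrow> f x \<in> sph n"
    and "\<And>x. x \<in> sph n \<Longrightarrow> f (- x) = - f x"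
  shows "odd (Brouwer_degree2 n f)"
  using assms
proof (induction n arbitrary: f)
  case 0
  define a :: "nat \<Rightarrow> real" where "a = (\<lambda>i. if i = 0 then 1 else 0)"
  have a: "a \<in> sph 0" by (simp add: a_def sph_def)
  have S: "x = a \<or> x = - a" if "x \<in> sph 0" for x
    using sph_0_cases[OF a that] .
  consider "f a = a" | "f a = - a" using S[OF "0.prems"(3)[OF a]] by blast
  then show ?case
  proof cases
    case 1
    then have "f x = id x" if "x \<in> sph 0" for x
      using S[OF that] "0.prems"(4)[OF a] 1 by (metis id_apply)
    then have "Brouwer_degree2 0 f = Brouwer_degree2 0 id"
      by (intro Brouwer_degree2_eq) (simp add: topspace_nsphere_eq_sph)
    then show ?thesis by simp
  next
    case 2
    have "- (- a) = a" by (simp add: fun_eq_iff)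
    then have "f x = - x" if "x \<in> sph 0" for x
      using S[OF that] "0.prems"(4)[OF a] 2 by metis
    moreover have "- x = (\<lambda>i. if i = 0 then - x i else x i)" if "x \<in> sph 0" for x
      using that by (auto simp: sph_def fun_eq_iff)
    ultimately have "Brouwer_degree2 0 f = Brouwer_degree2 0 (\<lambda>x i. if i = 0 then - x i else x i)"
      by (intro Brouwer_degree2_eq) (simp add: topspace_nsphere_eq_sph)
    then show ?thesis by (simp add: Brouwer_degree2_reflection)
  qed
next
  case (Suc n)
  let ?m = "Suc n"
  obtain q v where q: "continuous_on (sph ?m) q"
      "\<And>x i. x \<in> sph ?m \<Longrightarrow> i > ?m \<Longrightarrow> q x i = 0" "\<And>x. q (- x) = - q x"
      "\<And>x. x \<in> sph ?m \<Longrightarrow> (\<Sum>i\<le>?m. (f x i - q x i)\<^sup>2) < 1"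
    and v: "v ?m \<noteq> 0" "\<And>i. i > ?m \<Longrightarrow> v i = 0"
      "\<And>x c. x \<in> sph ?m \<Longrightarrow> x ?m = 0 \<Longrightarrow> q x \<noteq> (\<lambda>i. c * v i)"
    using odd_polynomial_general_position[where 'e='e, OF Suc.prems] by blast
  define G where "G = (\<lambda>(t::real, x::nat \<Rightarrow> real) i. f x i + t * (q x i - f x i))"
  \<comment> \<open>at \<open>t = 1\<close> this projects \<open>q\<close> along \<open>v\<close> to the equatorial hyperplane, completely on the equator
    and not at all at the poles\<close>
  define H where "H = (\<lambda>(t::real, x::nat \<Rightarrow> real) i. q x i - t * (1 - \<bar>x ?m\<bar>) * (q x ?m / v ?m) * v i)"
  have cont2: "continuous_on (A \<times> sph ?m) (\<lambda>p. g (snd p) i)" if "continuous_on (sph ?m) g" for A :: "real set" and g i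
    by (rule continuous_on_compose2[OF continuous_on_product_then_coordinatewise[OF that]
          continuous_on_snd[OF continuous_on_id]]) auto
  have "continuous_on ({0..1} \<times> sph ?m) (\<lambda>p i. f (snd p) i + fst p * (q (snd p) i - f (snd p) i))"
    by (intro continuous_intros cont2 q Suc.prems)
  then have contG: "continuous_on ({0..1} \<times> sph ?m) G"
    by (simp add: G_def case_prod_unfold)
  have "continuous_on ({0..1} \<times> sph ?m)
      (\<lambda>p i. q (snd p) i - fst p * (1 - \<bar>snd p ?m\<bar>) * (q (snd p) ?m / v ?m) * v i)"
    by (intro continuous_intros cont2 q cont2[of "\<lambda>x. x"]) (use v in auto)
  then have contH: "continuous_on ({0..1} \<times> sph ?m) H"
    by (simp add: H_def case_prod_unfold)
  have Gnz: "\<exists>i\<le>?m. G (t, x) i \<noteq> 0" if t: "t \<in> {0..1}" and x: "x \<in> sph ?m" for t x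
  \<comment> \<open>A zero would give \<open>f x = t * (f x - q x)\<close> coordinatewise, a vector
    of length 1 on the left and less than 1 on the right.\<close>
  proof (rule ccontr)
    assume "\<not> ?thesis"
    then have *: "f x i = - t * (q x i - f x i)" if "i \<le> ?m" for i
      using that by (simp add: G_def algebra_simps)
    have "1 = (\<Sum>i\<le>?m. (f x i)\<^sup>2)" using Suc.prems(3)[OF x] by (simp add: sph_def)
    also have "\<dots> = (\<Sum>i\<le>?m. t\<^sup>2 * (f x i - q x i)\<^sup>2)"
    proof (rule sum.cong)
      fix i assume "i \<in> {..?m}"
      then show "(f x i)\<^sup>2 = t\<^sup>2 * (f x i - q x i)\<^sup>2"
        using *[of i] by (metis (no_types, lifting) atMost_iff power2_commute power2_minus power_mult_distrib)
    qed simp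
    also have "\<dots> = t\<^sup>2 * (\<Sum>i\<le>?m. (f x i - q x i)\<^sup>2)"
      by (simp add: sum_distrib_left del: sum.atMost_Suc)
    also have "\<dots> \<le> (\<Sum>i\<le>?m. (f x i - q x i)\<^sup>2)"
      using t by (intro mult_left_le_one_le sum_nonneg) (auto simp: power_le_one)
    also have "\<dots> < 1" by (rule q(4)[OF x])
    finally show False by simp
  qed
  have qnz: "\<exists>i\<le>?m. q x i \<noteq> 0" if "x \<in> sph ?m" for x
    using Gnz[of 1 x] that by (simp add: G_def)
  have Hnz: "\<exists>i\<le>?m. H (t, x) i \<noteq> 0" if t: "t \<in> {0..1}" and x: "x \<in> sph ?m" for t x
  proof (rule ccontr)
    assume "\<not> ?thesis"
    then have Hz: "H (t, x) i = 0" if "i \<le> ?m" for i using that by blast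
    have *: "q x i = t * (1 - \<bar>x ?m\<bar>) * (q x ?m / v ?m) * v i" for i
    proof (cases "i \<le> ?m")
      case True
      then show ?thesis using Hz[of i] unfolding H_def prod.case by linarith
    next
      case False
      then show ?thesis using q(2)[OF x, of i] v(2)[of i] by simp
    qed
    \<comment> \<open>At a zero of \<open>H\<close>, \<open>q x\<close> is a multiple of
      \<open>v\<close>; coordinate \<open>?m\<close> determines the factor. Either
      \<open>q x\<close> vanishes, or \<open>t * (1 - \<bar>x ?m\<bar>) = 1\<close>, which puts
      \<open>x\<close> on the equator, where \<open>q x\<close> is never a multiple of
      \<open>v\<close>.\<close>
    then have "q x ?m = t * (1 - \<bar>x ?m\<bar>) * q x ?m"
      using *[of ?m] v(1) by (metis nonzero_eq_divide_eq times_divide_eq_left times_divide_eq_right)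
    then consider "q x ?m = 0" | "t * (1 - \<bar>x ?m\<bar>) = 1"
      by (metis mult_cancel_right1)
    then show False
    proof cases
      case 1
      then have "q x i = 0" for i using *[of i] by simp
      then show False using qnz[OF x] by blast
    next
      case 2
      have "t * (1 - \<bar>x ?m\<bar>) \<le> 1 - \<bar>x ?m\<bar>" if "1 - \<bar>x ?m\<bar> \<ge> 0"
        using t that by (intro mult_left_le_one_le) auto
      moreover have "t * (1 - \<bar>x ?m\<bar>) \<le> 0" if "1 - \<bar>x ?m\<bar> < 0"
        using t that by (simp add: mult_nonneg_nonpos)
      ultimately have "x ?m = 0" using 2 by linarith
      then show False using v(3)[OF x] * by (metis ext)
    qed
  qed
  define h where "h x = normalize_sph ?m (H (1, x))" for x
  have "Brouwer_degree2 ?m f = Brouwer_degree2 ?m (\<lambda>x. normalize_sph ?m (G (0, x)))"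
    by (rule Brouwer_degree2_eq)
       (simp add: topspace_nsphere_eq_sph G_def normalize_sph_id Suc.prems)
  also have "\<dots> = Brouwer_degree2 ?m (\<lambda>x. normalize_sph ?m (G (1, x)))"
    using q(2) Suc.prems(3)
    by (intro Brouwer_degree2_normalize_homotopy contG Gnz) (auto simp: G_def sph_def)
  \<comment> \<open>The two homotopies meet in \<open>q\<close>.\<close>
  also have "\<dots> = Brouwer_degree2 ?m (\<lambda>x. normalize_sph ?m (H (0, x)))"
    by (simp add: G_def H_def)
  also have "\<dots> = Brouwer_degree2 ?m h"
    unfolding h_def using q(2) v(2)
    by (intro Brouwer_degree2_normalize_homotopy contH Hnz) (auto simp: H_def)
  finally have deg: "Brouwer_degree2 ?m f = Brouwer_degree2 ?m h" .
  have h_in: "h x \<in> sph ?m" if "x \<in> sph ?m" for x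
    unfolding h_def using that q(2) v(2) Hnz[of 1 x] by (intro normalize_sph_in_sph) (auto simp: H_def)
  have h_odd: "h (- x) = - h x" for x
  proof -
    have "H (1, - x) = - H (1, x)" by (auto simp: H_def q(3) fun_eq_iff)
    then show ?thesis by (simp add: h_def normalize_sph_minus)
  qed
  have h_eq: "h x \<in> sph n" if "x \<in> sph n" for x
  proof -
    have x: "x \<in> sph ?m" "x ?m = 0" using equator_in_sph[OF that] by auto
    then have "h x ?m = 0" using v(1) by (simp add: h_def normalize_sph_def H_def)
    then show ?thesis using h_in[OF x(1)] by (rule_tac sph_equator)
  qed
  have conth: "continuous_on (sph ?m) h"
    unfolding h_def using Hnz
    by (intro continuous_on_normalize_sph continuous_on_compose2[OF contH]) (auto intro!: continuous_intros)
  have "even (Brouwer_degree2 ?m h - Brouwer_degree2 (?m - Suc 0) h)"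
  proof (rule Borsuk_odd_mapping_degree_step)
    show "continuous_map (nsphere ?m) (nsphere ?m) h"
      using conth h_in by (auto simp: nsphere_eq_top_of_sph)
    show "(h \<circ> (\<lambda>x i. - x i)) u = ((\<lambda>x i. - x i) \<circ> h) u" for u
      using h_odd[of u] by (simp add: fun_Compl_def)
    show "h \<in> topspace (nsphere (?m - Suc 0)) \<rightarrow> topspace (nsphere (?m - Suc 0))"
      using h_eq by (auto simp: topspace_nsphere_eq_sph)
  qed
  moreover have "odd (Brouwer_degree2 n h)"
    using Suc.prems(1) equator_in_sph
    by (intro Suc.IH h_eq h_odd continuous_on_subset[OF conth]) auto
  ultimately show ?case by (simp add: deg)
qed

text \<open>Without a zero, \<open>f\<close> normalizes to an odd self-map of the sphere, whose
  degree is odd; but coordinate \<open>n\<close> vanishes, so the map misses the pole and has degree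
  0.\<close>

theorem Borsuk_Ulam:
  fixes f :: "(nat \<Rightarrow> real) \<Rightarrow> nat \<Rightarrow> real"
  assumes dim: "n < DIM('e::euclidean_space)"
    and cont: "continuous_on (sph n) f"
    and odd: "\<And>x. x \<in> sph n \<Longrightarrow> f (- x) = - f x"
    and im: "\<And>x i. x \<in> sph n \<Longrightarrow> i \<ge> n \<Longrightarrow> f x i = 0"
  shows "\<exists>x\<in>sph n. \<forall>i. f x i = 0"
proof (rule ccontr)
  assume "\<not> ?thesis"
  then have nz: "\<exists>i\<le>n. f x i \<noteq> 0" if "x \<in> sph n" for x
    using that im[OF that] by (metis linear)
  define h where "h x = normalize_sph n (f x)" for x
  have conth: "continuous_on (sph n) h"
    unfolding h_def by (rule continuous_on_normalize_sph[OF cont nz])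
  have hin: "h x \<in> sph n" if "x \<in> sph n" for x
    unfolding h_def using nz[OF that] im[OF that] by (intro normalize_sph_in_sph) auto
  have "odd (Brouwer_degree2 n h)"
    by (rule Brouwer_degree2_odd[OF dim conth hin]) (auto simp: h_def odd normalize_sph_minus)
  moreover have "Brouwer_degree2 n h = 0"
  proof (rule Brouwer_degree2_nonsurjective)
    show "continuous_map (nsphere n) (nsphere n) h"
      using conth hin by (auto simp: nsphere_eq_top_of_sph)
    have "(\<lambda>i. if i = n then 1 else 0) \<in> sph n"
      by (simp add: sph_def if_distrib[of "\<lambda>x. x\<^sup>2"] cong: if_cong)
    moreover have "(\<lambda>i. if i = n then 1 else 0) \<noteq> h x" if "x \<in> sph n" for x
      using im[OF that, of n] by (auto simp: h_def normalize_sph_def fun_eq_iff intro!: exI[of _ n])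
    ultimately show "h ` topspace (nsphere n) \<noteq> topspace (nsphere n)"
      by (auto simp: topspace_nsphere_eq_sph)
  qed
  ultimately show False by simp
qed

section \<open>Medians\<close>

lemma continuous_on_Max_finite:
  fixes g :: "'i \<Rightarrow> 'b::topological_space \<Rightarrow> real"
  assumes "finite I" "I \<noteq> {}" "\<And>i. i \<in> I \<Longrightarrow> continuous_on S (g i)"
  shows "continuous_on S (\<lambda>x. Max ((\<lambda>i. g i x) ` I))"
  using assms by (induction I rule: finite_ne_induct) (auto intro!: continuous_intros)

lemma continuous_on_Min_finite:
  fixes g :: "'i \<Rightarrow> 'b::topological_space \<Rightarrow> real"
  assumes "finite I" "I \<noteq> {}" "\<And>i. i \<in> I \<Longrightarrow> continuous_on S (g i)"
  shows "continuous_on S (\<lambda>x. Min ((\<lambda>i. g i x) ` I))"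
  using assms by (induction I rule: finite_ne_induct) (auto intro!: continuous_intros)

text \<open>The entry of rank \<open>k + 1\<close> among \<open>2 * k + 1\<close> entries; the
  max-min form makes its continuity immediate.\<close>

definition median :: "nat \<Rightarrow> (nat \<Rightarrow> real) \<Rightarrow> real" where
  "median k y = Max ((\<lambda>A. Min (y ` A)) ` {A. A \<subseteq> {..2 * k} \<and> card A = Suc k})"

lemma median_index_sets:
  "finite {A. A \<subseteq> {..2 * k} \<and> card A = Suc k}" "{A. A \<subseteq> {..2 * k} \<and> card A = Suc k} \<noteq> {}"
proof -
  show "finite {A. A \<subseteq> {..2 * k} \<and> card A = Suc k}"
    by (rule finite_subset[of _ "Pow {..2 * k}"]) auto
  have "{..k} \<in> {A. A \<subseteq> {..2 * k} \<and> card A = Suc k}" by auto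
  then show "{A. A \<subseteq> {..2 * k} \<and> card A = Suc k} \<noteq> {}" by blast
qed

lemma continuous_on_median: "continuous_on S (median k)"
proof -
  have "continuous_on S (\<lambda>y. Min ((\<lambda>i. y i) ` A))" if "A \<subseteq> {..2 * k} \<and> card A = Suc k" for A
    using that by (intro continuous_on_Min_finite)
      (auto intro: finite_subset continuous_on_subset[OF continuous_on_product_coordinates])
  then show ?thesis
    unfolding median_def by (intro continuous_on_Max_finite median_index_sets) auto
qed

lemma card_above_median: "card {i. i \<le> 2 * k \<and> y i > median k y} \<le> k"
proof (rule ccontr)
  let ?B = "{i. i \<le> 2 * k \<and> y i > median k y}"
  assume "\<not> card ?B \<le> k"
  then have "Suc k \<le> card ?B" by simp
  then obtain A where A: "A \<subseteq> ?B" "card A = Suc k"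
    by (rule obtain_subset_with_card_n)
  have "finite A" "A \<noteq> {}" using A(2) by (auto intro: card_ge_0_finite)
  then have "Min (y ` A) > median k y" using A(1) by (subst Min_gr_iff) auto
  moreover have "Min (y ` A) \<le> median k y"
    unfolding median_def using A by (intro Max_ge) (auto simp: median_index_sets)
  ultimately show False by simp
qed

text \<open>A set \<open>A\<close> attaining the maximum has \<open>k + 1\<close> entries that are
  not below the median, which leaves only \<open>k\<close> indices.\<close>

lemma card_below_median: "card {i. i \<le> 2 * k \<and> y i < median k y} \<le> k"
proof -
  have "median k y \<in> (\<lambda>A. Min (y ` A)) ` {A. A \<subseteq> {..2 * k} \<and> card A = Suc k}"
    unfolding median_def 
    by (intro Max_in finite_imageI median_index_sets(1))
       (simp only: image_is_empty median_index_sets(2) not_False_eq_True)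
  then obtain A where A: "A \<subseteq> {..2 * k}" "card A = Suc k" "median k y = Min (y ` A)" by auto
  have "finite A" using A(1) finite_subset by blast
  then have "median k y \<le> y i" if "i \<in> A" for i using that by (simp add: A(3))
  then have "{i. i \<le> 2 * k \<and> y i < median k y} \<subseteq> {..2 * k} - A"
    by (auto simp: not_less[symmetric])
  then have "card {i. i \<le> 2 * k \<and> y i < median k y} \<le> card ({..2 * k} - A)"
    by (intro card_mono) auto
  also have "\<dots> = k" using A \<open>finite A\<close> by (simp add: card_Diff_subset)
  finally show ?thesis .
qed

text \<open>Otherwise two sets of at most \<open>k\<close> indices would cover all
  \<open>2 * k + 1\<close>.\<close>

lemma median_le_if_few_above:
  assumes "card {i. i \<le> 2 * k \<and> y i > c} \<le> k"
  shows "median k y \<le> c"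
proof (rule ccontr)
  assume *: "\<not> ?thesis"
  have "{..2 * k} \<subseteq> {i. i \<le> 2 * k \<and> y i > c} \<union> {i. i \<le> 2 * k \<and> y i < median k y}"
    using * by auto
  then have "card {..2 * k} \<le> card ({i. i \<le> 2 * k \<and> y i > c} \<union> {i. i \<le> 2 * k \<and> y i < median k y})"
    by (intro card_mono) auto
  also have "\<dots> \<le> k + k"
    using assms card_below_median[of k y] by (meson add_mono card_Un_le order_trans)
  finally show False by simp
qed

lemma median_ge_if_few_below:
  assumes "card {i. i \<le> 2 * k \<and> y i < c} \<le> k"
  shows "c \<le> median k y"
proof (rule ccontr)
  assume *: "\<not> ?thesis"
  have "{..2 * k} \<subseteq> {i. i \<le> 2 * k \<and> y i < c} \<union> {i. i \<le> 2 * k \<and> y i > median k y}"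
    using * by auto
  then have "card {..2 * k} \<le> card ({i. i \<le> 2 * k \<and> y i < c} \<union> {i. i \<le> 2 * k \<and> y i > median k y})"
    by (intro card_mono) auto
  also have "\<dots> \<le> k + k"
    using assms card_above_median[of k y] by (meson add_mono card_Un_le order_trans)
  finally show False by simp
qed

lemma median_minus: "median k (\<lambda>i. - y i) = - median k y"
proof (rule antisym)
  show "median k (\<lambda>i. - y i) \<le> - median k y"
    using card_below_median[of k y] by (intro median_le_if_few_above) simp
  show "- median k y \<le> median k (\<lambda>i. - y i)"
    using card_above_median[of k y] by (intro median_ge_if_few_below) simp
qed

section \<open>The deleted product\<close>

lemma geod_bounds: "norm u = 1 \<Longrightarrow> norm v = 1 \<Longrightarrow> 0 \<le> geod u v \<and> geod u v \<le> pi"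
  using Cauchy_Schwarz_ineq2[of u v] by (auto simp: geod_def abs_le_iff intro!: arccos_lbound arccos_ubound)

lemma bdd_above_geod:
  assumes "\<And>u. u \<in> S \<Longrightarrow> norm u = 1"
  shows "bdd_above {geod u v | u v. u \<in> S \<and> v \<in> S}"
  using assms geod_bounds by (auto intro!: bdd_aboveI[of _ pi])

text \<open>An admissible \<open>\<delta>\<close> below \<open>arccos r\<close> exists, and
  \<open>c = cos \<delta>\<close> works because the cosine decreases on
  \<open>[0, pi]\<close>.\<close>

lemma disc_delta_less_imp_local_inner_bound:
  fixes g :: "'b \<Rightarrow> 'a::real_inner"
  assumes unit: "\<And>x. x \<in> topspace X \<Longrightarrow> norm (g x) = 1"
    and less: "disc_delta X g < arccos r" and r: "-1 \<le> r" "r \<le> 1"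
  obtains c where "c > r"
    "\<And>x. x \<in> topspace X \<Longrightarrow> \<exists>U. openin X U \<and> x \<in> U \<and> (\<forall>y\<in>U. \<forall>z\<in>U. g y \<bullet> g z \<ge> c)"
proof -
  let ?D = "{\<delta>. \<delta> \<ge> 0 \<and> (\<forall>x\<in>topspace X. \<exists>U. openin X U \<and> x \<in> U \<and> geod_diam (g ` U) \<le> \<delta>)}"
  have unit': "norm u = 1" if "openin X U" "u \<in> g ` U" for U u
    using that unit openin_subset by fastforce
  have "geod_diam (g ` topspace X) \<le> pi" if "x \<in> topspace X" for x
    unfolding geod_diam_def
    by (rule cSup_least) (use that unit geod_bounds in blast)+
  \<comment> \<open>The infimum is informative only over a nonempty set; the whole space is a
    neighborhood witnessing \<open>pi\<close>.\<close>
  then have "pi \<in> ?D" by (auto intro!: exI[of _ "topspace X"])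
  then have "?D \<noteq> {}" by blast
  then obtain \<delta> where \<delta>: "\<delta> \<in> ?D" "\<delta> < arccos r"
    using cInf_lessD[of ?D "arccos r"] less unfolding disc_delta_def by blast
  have \<delta>0: "\<delta> \<ge> 0"
    and ex: "\<And>x. x \<in> topspace X \<Longrightarrow> \<exists>U. openin X U \<and> x \<in> U \<and> geod_diam (g ` U) \<le> \<delta>"
    using \<delta>(1) by simp_all
  have "arccos r \<le> pi" using r by (rule arccos_ubound)
  then have "cos \<delta> > cos (arccos r)"
    using \<delta>(2) \<delta>0 by (intro cos_monotone_0_pi)
  then have "cos \<delta> > r" using r by simp
  moreover have "\<exists>U. openin X U \<and> x \<in> U \<and> (\<forall>y\<in>U. \<forall>z\<in>U. g y \<bullet> g z \<ge> cos \<delta>)" if x: "x \<in> topspace X" for x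
  proof -
    obtain U where U: "openin X U" "x \<in> U" "geod_diam (g ` U) \<le> \<delta>" using ex[OF x] by blast
    have "g y \<bullet> g z \<ge> cos \<delta>" if "y \<in> U" "z \<in> U" for y z
    proof -
      have n: "norm (g y) = 1" "norm (g z) = 1" using unit'[OF U(1)] that by auto
      have "geod (g y) (g z) \<le> geod_diam (g ` U)"
        unfolding geod_diam_def using that
        by (intro cSup_upper bdd_above_geod unit'[OF U(1)]) blast+
      then have "geod (g y) (g z) \<le> \<delta>" using U by simp
      then have "cos (geod (g y) (g z)) \<ge> cos \<delta>"
        using geod_bounds[OF n] \<delta>(2) \<open>arccos r \<le> pi\<close> by (intro cos_monotone_0_pi_le) auto
      moreover have "\<bar>g y \<bullet> g z\<bar> \<le> 1" using Cauchy_Schwarz_ineq2[of "g y" "g z"] n by simp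
      ultimately show ?thesis by (simp add: geod_def cos_arccos_abs)
    qed
    then show ?thesis using U by blast
  qed
  ultimately show thesis by (rule that)
qed

section \<open>Compactness and symmetry of the deleted product\<close>

lemma compact_geom_face:
  assumes "finite \<sigma>"
  shows "compact (geom_face \<sigma>)"
proof -
  \<comment> \<open>By Tychonoff the cube is compact; the face is a closed subset of it.\<close>
  have "compactin (product_topology (\<lambda>i. euclideanreal) UNIV) (PiE UNIV (\<lambda>i::nat. {0..1::real}))"
    by (subst compactin_PiE) simp
  then have "compact (PiE UNIV (\<lambda>i::nat. {0..1::real}))"
    by (simp add: euclidean_product_topology)
  moreover have "closed (geom_face \<sigma>)"
    unfolding geom_face_def
    by (intro closed_Collect_conj closed_Collect_all closed_Collect_imp closed_Collect_le closed_Collect_eq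
        continuous_intros continuous_on_product_coordinates) auto
  moreover have "geom_face \<sigma> \<subseteq> PiE UNIV (\<lambda>i::nat. {0..1::real})"
  proof
    fix x assume x: "x \<in> geom_face \<sigma>"
    have "x i \<le> 1" for i
    proof (cases "i \<in> \<sigma>")
      case True
      then have "x i \<le> (\<Sum>i\<in>\<sigma>. x i)"
        using x assms by (intro member_le_sum) (auto simp: geom_face_def)
      then show ?thesis using x by (simp add: geom_face_def)
    qed (use x in \<open>auto simp: geom_face_def\<close>)
    then show "x \<in> PiE UNIV (\<lambda>i::nat. {0..1::real})"
      using x by (auto simp: geom_face_def)
  qed
  ultimately show ?thesis by (metis compact_Int_closed inf.absorb_iff2)
qed

lemma finite_skel_face: "\<sigma> \<in> skel_faces n k \<Longrightarrow> finite \<sigma>"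
  by (auto simp: skel_faces_def intro: finite_subset[of _ "{0..n}"])

lemma conf2_iff:
  "p \<in> conf2 n k \<longleftrightarrow> (\<exists>\<sigma>\<in>skel_faces n k. \<exists>\<tau>\<in>skel_faces n k.
     \<sigma> \<inter> \<tau> = {} \<and> fst p \<in> geom_face \<sigma> \<and> snd p \<in> geom_face \<tau>)"
  by (cases p) (auto simp: conf2_def skel_def)

lemma compact_conf2: "compact (conf2 n k)"
proof -
  have "finite (skel_faces n k)"
    by (rule finite_subset[of _ "Pow {0..n}"]) (auto simp: skel_faces_def)
  then have "compact (\<Union>\<sigma>\<in>skel_faces n k. \<Union>\<tau>\<in>{\<tau>\<in>skel_faces n k. \<sigma> \<inter> \<tau> = {}}.
      geom_face \<sigma> \<times> geom_face \<tau>)"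
    by (intro compact_UN ballI compact_Times compact_geom_face finite_skel_face) auto
  also have "(\<Union>\<sigma>\<in>skel_faces n k. \<Union>\<tau>\<in>{\<tau>\<in>skel_faces n k. \<sigma> \<inter> \<tau> = {}}.
      geom_face \<sigma> \<times> geom_face \<tau>) = conf2 n k"
    unfolding set_eq_iff conf2_iff by (simp add: mem_Times_iff) blast
  finally show ?thesis .
qed

lemma swap_in_conf2: "p \<in> conf2 n k \<Longrightarrow> prod.swap p \<in> conf2 n k"
  unfolding conf2_iff fst_swap snd_swap by (metis inf_commute)

lemma P_map_swap: "P_map f (prod.swap p) = - P_map f p"
  by (cases p) (simp add: P_map_def norm_minus_commute flip: scaleR_minus_right)

lemma norm_P_map:
  assumes "almost_injective n k f" "p \<in> conf2 n k"
  shows "norm (P_map f p) = 1"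
proof -
  have "f (fst p) \<noteq> f (snd p)"
    using assms unfolding conf2_iff almost_injective_def by blast
  then show ?thesis by (simp add: P_map_def case_prod_unfold)
qed

theorem deleted_product_odd_map_has_zero:
  fixes F :: "(nat \<Rightarrow> real) \<times> (nat \<Rightarrow> real) \<Rightarrow> 'a::euclidean_space"
  assumes d: "d \<ge> 1" and dim: "DIM('a) = 2 * d"
    and cont: "continuous_on UNIV F" and odd: "\<And>p. F (prod.swap p) = - F p"
  shows "\<exists>p\<in>conf2 (2 * d + 2) d. F p = 0"
proof -
  let ?k = "Suc d"
  let ?n = "2 * d + 1"
  obtain b :: "nat \<Rightarrow> 'a" where b: "bij_betw b {..<2 * d} Basis"
    using ex_bij_betw_nat_finite[of "Basis :: 'a set"] dim by (auto simp: atLeast0LessThan)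
  \<comment> \<open>Coordinates in \<open>0..2d+2\<close> with median \<open>0\<close> are points of the cone over the deleted join of the
    \<open>d\<close>-skeleton with itself, and subtracting the median identifies this cone with
    \<open>\<real>\<^sup>2\<^sup>d\<^sup>+\<^sup>3\<close> modulo constants, i.e. with the points whose last coordinate is \<open>0\<close>.\<close>
  define z where "z x = (\<lambda>i. if i \<le> 2 * ?k then x i - median ?k x else 0)" for x :: "nat \<Rightarrow> real"
  define r where "r x = (\<Sum>i\<le>2 * ?k. \<bar>z x i\<bar>)" for x
  \<comment> \<open>The factor 2 gives \<open>P x\<close> and \<open>N x\<close> total mass 2
    together, so equal masses are both 1.\<close>
  define P where "P x = (\<lambda>i. 2 * max 0 (z x i) / r x)" for x
  define N where "N x = (\<lambda>i. 2 * max 0 (- z x i) / r x)" for x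
  \<comment> \<open>Coordinate \<open>2 * d\<close> compares the two join parameters: where it
    vanishes, \<open>(P x, N x)\<close> lies in the deleted product.\<close>
  define \<Phi> where "\<Phi> x = (\<lambda>i. if i < 2 * d then F (P x, N x) \<bullet> b i
      else if i = 2 * d then (\<Sum>j\<le>2 * ?k. P x j - N x j) else 0)" for x
  have z_minus: "z (- x) = - z x" for x
    by (auto simp: z_def fun_eq_iff median_minus fun_Compl_def)
  have r_minus: "r (- x) = r x" for x by (simp add: r_def z_minus)
  have PN_minus: "P (- x) = N x" "N (- x) = P x" for x
    by (auto simp: P_def N_def z_minus r_minus)
  have \<Phi>_odd: "\<Phi> (- x) = - \<Phi> x" for x
    using odd[of "(P x, N x)"]
    by (auto simp: \<Phi>_def PN_minus fun_eq_iff sum_subtractf)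
  have r_pos: "r x > 0" if x: "x \<in> sph ?n" for x
  proof (rule ccontr)
    assume "\<not> ?thesis"
    moreover have "r x \<ge> 0" by (auto simp: r_def intro: sum_nonneg)
    ultimately have "r x = 0" by simp
    then have z0: "z x i = 0" if "i \<le> 2 * ?k" for i
      using that unfolding r_def by (subst (asm) sum_nonneg_eq_0_iff) auto
    \<comment> \<open>The last index \<open>2 * ?k = ?n + 1\<close> is beyond the sphere
      coordinates, so \<open>z x\<close> vanishing there forces the median to be 0.\<close>
    have "x (2 * ?k) = 0" using x by (simp add: sph_def)
    then have "median ?k x = 0" using z0[of "2 * ?k"] by (simp add: z_def)
    then have "x i = 0" if "i \<le> ?n" for i using z0[of i] that by (simp add: z_def)
    then show False using sph_imp_nonzero[OF x] by blast
  qed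
  have cz: "continuous_on (sph ?n) (\<lambda>x. z x i)" for i
    unfolding z_def
    by (cases "i \<le> 2 * ?k") (auto intro!: continuous_intros continuous_on_median
        intro: continuous_on_subset[OF continuous_on_product_coordinates])
  have cr: "continuous_on (sph ?n) r"
    unfolding r_def by (intro continuous_intros cz)
  have r_nz: "\<forall>x\<in>sph ?n. r x \<noteq> 0" using r_pos by force
  have cP: "continuous_on (sph ?n) (\<lambda>x. P x i)" and cN: "continuous_on (sph ?n) (\<lambda>x. N x i)" for i
    unfolding P_def N_def by (intro continuous_intros cz cr r_nz)+
  have cF: "continuous_on (sph ?n) (\<lambda>x. F (P x, N x))"
    by (rule continuous_on_compose2[OF cont])
       (intro continuous_on_Pair continuous_on_coordinatewise_then_product cP cN subset_UNIV)+
  have c\<Phi>: "continuous_on (sph ?n) \<Phi>"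
  proof (rule continuous_on_coordinatewise_then_product)
    fix i
    consider "i < 2 * d" | "i = 2 * d" | "i > 2 * d" by linarith
    moreover have "continuous_on (sph ?n) (\<lambda>x. F (P x, N x) \<bullet> b i)"
      by (intro continuous_intros cF)
    moreover have "continuous_on (sph ?n) (\<lambda>x. \<Sum>j\<le>2 * ?k. P x j - N x j)"
      by (intro continuous_intros cP cN)
    ultimately show "continuous_on (sph ?n) (\<lambda>x. \<Phi> x i)"
      by cases (simp_all add: \<Phi>_def del: sum.atMost_Suc)
  qed
  \<comment> \<open>The product type provides dimension \<open>4 * d\<close>, which exceeds
    \<open>2 * d + 1\<close> as \<open>d \<ge> 1\<close>.\<close>
  have "?n < DIM('a \<times> 'a)" using d dim by simp
  then obtain x where x: "x \<in> sph ?n" and x0: "\<And>i. \<Phi> x i = 0"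
    using Borsuk_Ulam[where 'e = "'a \<times> 'a", of ?n \<Phi>] c\<Phi> \<Phi>_odd by (auto simp: \<Phi>_def)
  have "F (P x, N x) \<bullet> u = 0" if u: "u \<in> Basis" for u
  proof -
    obtain i where "i < 2 * d" "u = b i" using b u by (auto simp: bij_betw_def)
    then show ?thesis using x0[of i] by (simp add: \<Phi>_def)
  qed
  then have "F (P x, N x) = 0" using euclidean_all_zero_iff by blast
  moreover have "(P x, N x) \<in> conf2 (2 * d + 2) d"
  proof -
    \<comment> \<open>Among the \<open>2 * d + 3\<close> vertices at most \<open>d + 1\<close> lie
      on either side of the median, exactly the size allowed for faces of the
      \<open>d\<close>-skeleton.\<close>
    define \<sigma> where "\<sigma> = {i. i \<le> 2 * ?k \<and> x i > median ?k x}"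
    define \<tau> where "\<tau> = {i. i \<le> 2 * ?k \<and> x i < median ?k x}"
    note r = r_pos[OF x]
    have PN: "P x i \<ge> 0" "N x i \<ge> 0" for i using r by (auto simp: P_def N_def)
    have P0: "P x i = 0" if "i \<notin> \<sigma>" for i using that by (auto simp: P_def z_def \<sigma>_def)
    have N0: "N x i = 0" if "i \<notin> \<tau>" for i using that by (auto simp: N_def z_def \<tau>_def)
    have "(\<Sum>i\<le>2 * ?k. P x i) + (\<Sum>i\<le>2 * ?k. N x i) = (\<Sum>i\<le>2 * ?k. 2 * \<bar>z x i\<bar> / r x)"
      unfolding sum.distrib[symmetric] by (intro sum.cong refl) (auto simp: P_def N_def max_def abs_if)
    also have "\<dots> = 2" using r
      by (simp add: r_def del: sum.atMost_Suc flip: sum_divide_distrib sum_distrib_left)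
    finally have "(\<Sum>i\<le>2 * ?k. P x i) + (\<Sum>i\<le>2 * ?k. N x i) = 2" .
    moreover have "(\<Sum>i\<le>2 * ?k. P x i) - (\<Sum>i\<le>2 * ?k. N x i) = 0"
      using x0[of "2 * d"] by (simp add: \<Phi>_def sum_subtractf del: sum.atMost_Suc)
    ultimately have sums: "(\<Sum>i\<le>2 * ?k. P x i) = 1" "(\<Sum>i\<le>2 * ?k. N x i) = 1" by linarith+
    have "(\<Sum>i\<in>\<sigma>. P x i) = (\<Sum>i\<le>2 * ?k. P x i)" "(\<Sum>i\<in>\<tau>. N x i) = (\<Sum>i\<le>2 * ?k. N x i)"
      using P0 N0 by (intro sum.mono_neutral_left; auto simp: \<sigma>_def \<tau>_def)+
    then have s1: "(\<Sum>i\<in>\<sigma>. P x i) = 1" "(\<Sum>i\<in>\<tau>. N x i) = 1" using sums by simp_all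
    then have "\<sigma> \<noteq> {}" "\<tau> \<noteq> {}" by auto
    then have "\<sigma> \<in> skel_faces (2 * d + 2) d" "\<tau> \<in> skel_faces (2 * d + 2) d"
      using card_above_median[of ?k x] card_below_median[of ?k x]
      by (auto simp: skel_faces_def \<sigma>_def \<tau>_def)
    moreover have "\<sigma> \<inter> \<tau> = {}" by (auto simp: \<sigma>_def \<tau>_def)
    moreover have "P x \<in> geom_face \<sigma>" "N x \<in> geom_face \<tau>"
      using PN P0 N0 s1 by (auto simp: geom_face_def)
    ultimately show ?thesis unfolding conf2_iff by auto
  qed
  ultimately show ?thesis by blast
qed

theorem theorem3p11:
  fixes d :: nat and f :: "(nat \<Rightarrow> real) \<Rightarrow> 'a::euclidean_space"
  assumes "d \<ge> 1"
    and "DIM('a) = 2 * d"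
    and "almost_injective (2 * d + 2) d f"
  shows "alpha2 (2 * d + 2) d f \<ge> r_const (2 * d - 1)"
proof (rule ccontr)
  let ?C = "conf2 (2 * d + 2) d"
  assume "\<not> ?thesis"
  moreover have "r_const (2 * d - 1) = arccos (- 1 / DIM('a))"
    using assms(1,2) by (simp add: r_const_def of_nat_diff)
  ultimately have less: "disc_delta (top_of_set ?C) (P_map f) < arccos (- 1 / DIM('a))"
    by (simp add: alpha2_def)
  obtain c where c: "c > - 1 / DIM('a)"
    "\<And>p. p \<in> ?C \<Longrightarrow> \<exists>U. openin (top_of_set ?C) U \<and> p \<in> U \<and> (\<forall>x\<in>U. \<forall>y\<in>U. P_map f x \<bullet> P_map f y \<ge> c)"
    by (rule disc_delta_less_imp_local_inner_bound[OF _ less])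
       (use assms(1) in \<open>simp_all add: norm_P_map[OF assms(3)] assms(2) field_simps\<close>)
  obtain F where "continuous_on UNIV F" "\<And>p. F (prod.swap p) = - F p" "\<And>p. p \<in> ?C \<Longrightarrow> F p \<noteq> (0::'a)"
    by (rule odd_map_continuous_approximation[OF compact_conf2 swap_in_conf2 P_map_swap
          norm_P_map[OF assms(3)] c(2) c(1)]) blast+
  then show False
    using deleted_product_odd_map_has_zero[OF assms(1,2), of F] by blast
qed

end
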